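(* Let $z_1,\dots,z_{m+1}\in\mathbb{C}$ be pairwise distinct nodes, $v_1,\dots,v_{m+1}\in\mathbb{C}\setminus\{0\}$ weights, and $\xi_1,\dots,\xi_m\in\overline{\mathbb{C}}=\mathbb{C}\cup\{\infty\}$ poles, none of which is equal to a node. Let the unitary matrix $Q\in\mathbb{C}^{m\times m}$ and the proper Hessenberg pencil $(H,K)$, $H,K\in\mathbb{C}^{m\times m}$, be the solution of the Hessenberg pencil inverse eigenvalue problem (HPIEP) of size $m$ with nodes $z_1,\dots,z_m$, weights $v_1,\dots,v_m$ and poles $\xi_1,\dots,\xi_{m-1}$. Let $$\widehat Q=\begin{bmatrix}Q&\\&1\end{bmatrix},\quad \widehat H=\begin{bmatrix}H&\\&\hat h\end{bmatrix},\quad \widehat K=\begin{bmatrix}K&\\&\hat k\end{bmatrix},\qquad\text{where } z_{m+1}\hat k=\hat h .$$ Then there exist plane rotations $P_i,\dot P_i\in\mathfrak{P}_i$, $i=1,\dots,m$, such that $$\widetilde H=P_mP_{m-1}\cdots P_1\,\widehat H\,\dot P_1\dot P_2\cdots\dot P_m,\quad \widetilde K=P_mP_{m-1}\cdots P_1\,\widehat K\,\dot P_1\dot P_2\cdots\dot P_m,\quad \widetilde Q=\widehat Q\,P_1^HP_2^H\cdots P_m^H$$ solve the HPIEP of size $m+1$ with nodes $z_1,\dots,z_{m+1}$, weights $v_1,\dots,v_{m+1}$ and poles $\xi_1,\dots,\xi_m$, which is obtained by adding the node $z_{m+1}$, weight $v_{m+1}$ and pole $\xi_m$ to the original problem.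
   Context: HPIEP of size $n$: given $Z=\mathrm{diag}(z_1,\dots,z_n)$ with distinct $z_i\in\mathbb{C}$, a weight vector $v=[v_1\ \cdots\ v_n]^\top\in\mathbb{C}^n$ and poles $\xi_1,\dots,\xi_{n-1}\in\overline{\mathbb{C}}$, construct a pencil $(H,K)$ of upper Hessenberg $n\times n$ matrices with $h_{i+1,i}/k_{i+1,i}=\xi_i$, $i=1,\dots,n-1$, and a unitary matrix $Q\in\mathbb{C}^{n\times n}$ such that $$Q^HZQK=H\qquad\text{and}\qquad Qe_1=\frac{v}{\|v\|}.$$ A Hessenberg pencil is proper if $h_{i+1,i}$ and $k_{i+1,i}$ are never simultaneously zero; a ratio with zero denominator and nonzero numerator is $\infty$. Plane rotations: $\mathfrak{P}_i$, $1\le i\le m$, is the set of $(m+1)\times(m+1)$ matrices $$\begin{bmatrix}I_{i-1}&&&\\&\bar a&&-\bar b\\&&I_{m-i}&\\&b&&a\end{bmatrix},\qquad a,b\in\mathbb{C},\ \bar aa+\bar bb=1,$$ acting nontrivially only in rows and columns $i$ and $m+1$.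
   Formalization: A solution of the HPIEP is required to have a regular pencil (det(H − xK) not identically zero; also proved for the new pencil), and k̂ ≠ 0 is assumed; without these the claim fails, e.g. for m = 1 with H = K = 0 or with ĥ = k̂ = 0. *)

theory Defs
  imports
    "HOL-Analysis.L2_Norm"
    "Jordan_Normal_Form.Schur_Decomposition"
begin

text \<open>
  All indices are 0-based: index \<open>i\<close> here is index \<open>i + 1\<close> in the usual
  notation. Nodes, weights and poles are functions on \<open>nat\<close>; a problem of size
  \<open>n\<close> only reads \<open>z i\<close>, \<open>v i\<close> for \<open>i < n\<close> and \<open>\<xi> i\<close> for \<open>i + 1 < n\<close>.

  A point of the extended complex plane is a \<open>complex option\<close>, with \<open>None\<close> as the
  point at infinity (the convention of \<open>Alexandroff_compactification\<close>).
\<close>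

definition unitary_mat :: "nat \<Rightarrow> complex mat \<Rightarrow> bool" where
  "unitary_mat n Q \<longleftrightarrow> Q \<in> carrier_mat n n \<and>
     mat_adjoint Q * Q = 1\<^sub>m n \<and> Q * mat_adjoint Q = 1\<^sub>m n"

definition upper_hessenberg :: "nat \<Rightarrow> complex mat \<Rightarrow> bool" where
  "upper_hessenberg n A \<longleftrightarrow> A \<in> carrier_mat n n \<and>
     (\<forall>i<n. \<forall>j<n. i > j + 1 \<longrightarrow> A $$ (i, j) = 0)"

definition proper_hessenberg_pencil :: "nat \<Rightarrow> complex mat \<Rightarrow> complex mat \<Rightarrow> bool" where
  "proper_hessenberg_pencil n H K \<longleftrightarrow> upper_hessenberg n H \<and> upper_hessenberg n K \<and>
     (\<forall>i. i + 1 < n \<longrightarrow> \<not> (H $$ (i + 1, i) = 0 \<and> K $$ (i + 1, i) = 0))"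

definition regular_pencil :: "complex mat \<Rightarrow> complex mat \<Rightarrow> bool" where
  "regular_pencil H K \<longleftrightarrow> (\<exists>x. det (H - x \<cdot>\<^sub>m K) \<noteq> 0)"

text \<open>Only meaningful when \<open>h\<close> and \<open>k\<close> are not both zero.\<close>

definition ext_ratio :: "complex \<Rightarrow> complex \<Rightarrow> complex option" where
  "ext_ratio h k = (if k = 0 then None else Some (h / k))"

text \<open>
  \<open>hpiep_solution n z v \<xi> Q H K\<close>: the unitary matrix \<open>Q\<close> and the pencil \<open>(H, K)\<close>
  solve the Hessenberg pencil inverse eigenvalue problem of size \<open>n\<close> with nodes
  \<open>z\<close>, weights \<open>v\<close> and poles \<open>\<xi>\<close>.

  Regularity is what makes the nodes the eigenvalues of the pencil. It does not follow
  from the other conditions: for \<open>n = 1\<close> they hold with \<open>H = K = 0\<close>, and for any \<open>n\<close>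
  the last columns of \<open>H\<close> and \<open>K\<close> may be replaced by zero.
\<close>

definition hpiep_solution ::
  "nat \<Rightarrow> (nat \<Rightarrow> complex) \<Rightarrow> (nat \<Rightarrow> complex) \<Rightarrow> (nat \<Rightarrow> complex option) \<Rightarrow>
   complex mat \<Rightarrow> complex mat \<Rightarrow> complex mat \<Rightarrow> bool" where
  "hpiep_solution n z v \<xi> Q H K \<longleftrightarrow>
     unitary_mat n Q \<and>
     proper_hessenberg_pencil n H K \<and>
     regular_pencil H K \<and>
     (\<forall>i. i + 1 < n \<longrightarrow> ext_ratio (H $$ (i + 1, i)) (K $$ (i + 1, i)) = \<xi> i) \<and>
     mat_adjoint Q * mat_diag n z * Q * K = H \<and>
     col Q 0 = vec n (\<lambda>i. v i / complex_of_real (L2_set (\<lambda>j. cmod (v j)) {..<n}))"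

text \<open>Rotations of size \<open>m + 1\<close> acting on rows and columns \<open>i\<close> and \<open>m\<close>, for \<open>i < m\<close>.\<close>

definition plane_rotations :: "nat \<Rightarrow> nat \<Rightarrow> complex mat set" where
  "plane_rotations m i =
     {mat (m + 1) (m + 1) (\<lambda>(r, c).
        if r = i \<and> c = i then cnj a
        else if r = i \<and> c = m then - cnj b
        else if r = m \<and> c = i then b
        else if r = m \<and> c = m then a
        else if r = c then 1 else 0) | a b. cnj a * a + cnj b * b = 1}"

definition mat_prod_list :: "nat \<Rightarrow> complex mat list \<Rightarrow> complex mat" where
  "mat_prod_list n As = foldr (*) As (1\<^sub>m n)"

text \<open>The block diagonal matrix with blocks \<open>A\<close> and the \<open>1 \<times> 1\<close> block \<open>x\<close>.\<close>

definition border_mat :: "complex mat \<Rightarrow> complex \<Rightarrow> complex mat" where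
  "border_mat A x = diag_block_mat [A, mat 1 1 (\<lambda>_. x)]"

end

theory Submission
  imports Defs
begin

text \<open>
  All transformations are unitary, so the relation between \<open>Q\<close> and the pencil survives every step and
  regularity amounts to the invertibility of the second matrix. The rotation \<open>P 0\<close> is determined by the
  first column of the new \<open>Q\<close> and fills the last row. From then on the bulge is chased along the
  last row: the column rotation \<open>Pdot i\<close> gives the entries \<open>(m, i)\<close> of the pencil the ratio
  \<open>\<xi> i\<close>, and since the entries \<open>(i + 1, i)\<close> have the same ratio, a single row rotation
  \<open>P (i + 1)\<close> annihilates \<open>(m, i)\<close> in both matrices. The entries left at \<open>(i + 1, i)\<close> can only vanish in
  both matrices if the pencil deflates, which would put the first column of \<open>Q\<close> into a proper invariant
  subspace of the diagonal matrix of nodes. That is impossible, because the nodes are distinct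
  and the weights nonzero.
\<close>

section \<open>Unitary equivalence of pencils\<close>

lemma mat_adjoint_carrier:
  "A \<in> carrier_mat n k \<Longrightarrow> mat_adjoint A \<in> carrier_mat k n"
  by (auto simp: mat_adjoint_def)

lemma index_mat_adjoint:
  fixes A :: "complex mat"
  shows "A \<in> carrier_mat n k \<Longrightarrow> i < k \<Longrightarrow> j < n \<Longrightarrow> mat_adjoint A $$ (i, j) = cnj (A $$ (j, i))"
  by (auto simp: mat_adjoint_def mat_of_rows_def)

lemma mat_adjoint_mat_adjoint:
  fixes A :: "complex mat"
  assumes "A \<in> carrier_mat n k"
  shows "mat_adjoint (mat_adjoint A) = A"
  by (rule eq_matI) (use assms mat_adjoint_carrier[OF assms] mat_adjoint_carrier[OF mat_adjoint_carrier[OF assms]]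
      in \<open>auto simp: index_mat_adjoint[of _ n k] index_mat_adjoint[of _ k n]\<close>)

lemma mat_adjoint_mult:
  fixes A B :: "complex mat"
  assumes A: "A \<in> carrier_mat n k" and B: "B \<in> carrier_mat k l"
  shows "mat_adjoint (A * B) = mat_adjoint B * mat_adjoint A"
proof (rule eq_matI)
  have AB: "A * B \<in> carrier_mat n l" using A B by simp
  note adj = mat_adjoint_carrier[OF A] mat_adjoint_carrier[OF B]
  show "dim_row (mat_adjoint (A * B)) = dim_row (mat_adjoint B * mat_adjoint A)"
    "dim_col (mat_adjoint (A * B)) = dim_col (mat_adjoint B * mat_adjoint A)"
    using adj mat_adjoint_carrier[OF AB] by auto
  fix i j
  assume "i < dim_row (mat_adjoint B * mat_adjoint A)" "j < dim_col (mat_adjoint B * mat_adjoint A)"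
  then have ij: "i < l" "j < n" using adj by auto
  have "mat_adjoint (A * B) $$ (i, j) = (\<Sum>q<k. cnj (A $$ (j, q)) * cnj (B $$ (q, i)))"
    using A B ij by (simp add: index_mat_adjoint[OF AB] scalar_prod_def atLeast0LessThan)
  also have "\<dots> = (mat_adjoint B * mat_adjoint A) $$ (i, j)"
    using A B adj ij
    by (auto simp: scalar_prod_def atLeast0LessThan index_mat_adjoint[OF A] index_mat_adjoint[OF B]
        intro!: sum.cong)
  finally show "mat_adjoint (A * B) $$ (i, j) = (mat_adjoint B * mat_adjoint A) $$ (i, j)" .
qed

lemma unitary_matD:
  assumes "unitary_mat n P"
  shows "P \<in> carrier_mat n n" "mat_adjoint P * P = 1\<^sub>m n" "P * mat_adjoint P = 1\<^sub>m n"
    "mat_adjoint P \<in> carrier_mat n n"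
  using assms by (auto simp: unitary_mat_def mat_adjoint_carrier)

lemma unitary_mat_adjoint: "unitary_mat n P \<Longrightarrow> unitary_mat n (mat_adjoint P)"
  by (auto simp: unitary_mat_def mat_adjoint_mat_adjoint mat_adjoint_carrier)

lemma unitary_cancel:
  assumes "unitary_mat n P" "X \<in> carrier_mat n k"
  shows "mat_adjoint P * (P * X) = X" "P * (mat_adjoint P * X) = X"
proof -
  note P = unitary_matD[OF assms(1)]
  show "mat_adjoint P * (P * X) = X"
    using assoc_mult_mat[OF P(4,1) assms(2), symmetric] P(2) assms(2) by simp
  show "P * (mat_adjoint P * X) = X"
    using assoc_mult_mat[OF P(1,4) assms(2), symmetric] P(3) assms(2) by simp
qed

lemma unitary_mat_mult:
  assumes P: "unitary_mat n P" and R: "unitary_mat n R"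
  shows "unitary_mat n (P * R)"
proof -
  note P' = unitary_matD[OF P] and R' = unitary_matD[OF R]
  note assoc = assoc_mult_mat[of _ n n _ n _ n] mult_carrier_mat[of _ n n _ n]
  show ?thesis
    unfolding unitary_mat_def mat_adjoint_mult[OF P'(1) R'(1)]
    using P' R' by (simp add: assoc unitary_cancel[OF P] unitary_cancel[OF R])
qed

lemma unitary_mat_one: "unitary_mat n (1\<^sub>m n)"
proof -
  have "mat_adjoint (1\<^sub>m n :: complex mat) = 1\<^sub>m n"
    by (rule eq_matI)
      (auto simp: index_mat_adjoint[of _ n n] carrier_matD[OF mat_adjoint_carrier[OF one_carrier_mat]])
  then show ?thesis by (simp add: unitary_mat_def)
qed

lemma det_unitary_mat:
  assumes "unitary_mat n P"
  shows "det P \<noteq> 0"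
proof
  note P = unitary_matD[OF assms]
  assume "det P = 0"
  then have "det (mat_adjoint P * P) = 0"
    using det_mult[OF P(4,1)] by simp
  then show False using P(2) by simp
qed

text \<open>The invariant carried through every transformation. Hessenberg shape, poles and first
  column are kept apart because they are disturbed on the way. \<open>det B \<noteq> 0\<close>
  stands for regularity, to which it is equivalent under this relation, and it passes through
  products directly.\<close>

definition pencil_relation ::
  "nat \<Rightarrow> (nat \<Rightarrow> complex) \<Rightarrow> complex mat \<Rightarrow> complex mat \<Rightarrow> complex mat \<Rightarrow> bool" where
  "pencil_relation n z Q A B \<longleftrightarrow> unitary_mat n Q \<and> A \<in> carrier_mat n n \<and> B \<in> carrier_mat n n \<and>
     mat_adjoint Q * mat_diag n z * Q * B = A \<and> det B \<noteq> 0"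

lemma pencil_relation_mult_right:
  assumes rel: "pencil_relation n z Q A B" and R: "unitary_mat n R"
  shows "pencil_relation n z Q (A * R) (B * R)"
proof -
  have Q: "unitary_mat n Q" and A: "A \<in> carrier_mat n n" and B: "B \<in> carrier_mat n n"
    and eq: "A = mat_adjoint Q * mat_diag n z * Q * B" and det: "det B \<noteq> 0"
    using rel by (auto simp: pencil_relation_def)
  note R' = unitary_matD[OF R] and Q' = unitary_matD[OF Q]
  have "mat_adjoint Q * mat_diag n z * Q * (B * R) = A * R"
    unfolding eq using R' Q' B
    by (simp add: assoc_mult_mat[of _ n n _ n _ n] mult_carrier_mat[of _ n n _ n])
  then show ?thesis
    using det det_unitary_mat[OF R] R'(1) Q A B by (simp add: pencil_relation_def det_mult)
qed

text \<open>The row transformation is compensated in \<open>Q\<close>: the inner factor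
  \<open>mat_adjoint P * P\<close> of the new relation cancels.\<close>

lemma pencil_relation_mult_left:
  assumes rel: "pencil_relation n z Q A B" and P: "unitary_mat n P"
  shows "pencil_relation n z (Q * mat_adjoint P) (P * A) (P * B)"
proof -
  have Q: "unitary_mat n Q" and A: "A \<in> carrier_mat n n" and B: "B \<in> carrier_mat n n"
    and eq: "A = mat_adjoint Q * mat_diag n z * Q * B" and det: "det B \<noteq> 0"
    using rel by (auto simp: pencil_relation_def)
  note P' = unitary_matD[OF P] and Q' = unitary_matD[OF Q]
  have "mat_adjoint (Q * mat_adjoint P) * mat_diag n z * (Q * mat_adjoint P) * (P * B) = P * A"
    unfolding mat_adjoint_mult[OF Q'(1) P'(4)] mat_adjoint_mat_adjoint[OF P'(1)] eq
    using P' Q' B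
    by (simp add: assoc_mult_mat[of _ n n _ n _ n] mult_carrier_mat[of _ n n _ n]
        unitary_cancel(1)[OF P, of _ n])
  then show ?thesis
    using det det_unitary_mat[OF P] P'(1) A B unitary_mat_mult[OF Q unitary_mat_adjoint[OF P]]
    by (simp add: pencil_relation_def det_mult)
qed

section \<open>Irreducibility and regularity\<close>

text \<open>The zero lower left block makes the determinant factor, so the leading block
  \<open>B1\<close> is invertible. Solving with \<open>B1\<close> and padding with zeros gives the
  preimage: \<open>B\<close> maps the span of the first \<open>k\<close> unit vectors onto
  itself.\<close>

lemma block_upper_triangular_surj:
  fixes B :: "complex mat"
  assumes B: "B \<in> carrier_mat n n" and det: "det B \<noteq> 0" and k: "k < n"
    and zero: "\<And>r c. k \<le> r \<Longrightarrow> r < n \<Longrightarrow> c < k \<Longrightarrow> B $$ (r, c) = 0"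
    and u: "u \<in> carrier_vec n" "\<And>r. k \<le> r \<Longrightarrow> r < n \<Longrightarrow> u $ r = 0"
  obtains u' where "u' \<in> carrier_vec n" "\<And>r. k \<le> r \<Longrightarrow> r < n \<Longrightarrow> u' $ r = 0" "B *\<^sub>v u' = u"
proof -
  define l where "l = n - k"
  have n: "n = k + l" using k by (simp add: l_def)
  obtain B1 B2 B3 B4 where sp: "split_block B k k = (B1, B2, B3, B4)"
    by (metis prod_cases4)
  have dims: "dim_row B = k + l" "dim_col B = k + l" using B n by auto
  note S = split_block[OF sp dims]
  have B3: "B3 = 0\<^sub>m l k"
    using sp zero n dims unfolding split_block_def Let_def by (auto intro!: eq_matI)
  have "det B = det B1 * det B4"
    using det_four_block_mat_lower_left_zero[OF S(1,2) B3 S(4)] S(5) by simp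
  then have "det B1 \<noteq> 0" using det by auto
  from det_non_zero_imp_unit[OF S(1) this, unfolded Units_def, of "()"]
  obtain C where C: "C \<in> carrier_mat k k" "B1 * C = 1\<^sub>m k"
    by (auto simp: ring_mat_def)
  define u1 where "u1 = vec_first u k"
  have u1: "u1 \<in> carrier_vec k" by (simp add: u1_def)
  have u_eq: "u = u1 @\<^sub>v 0\<^sub>v l"
    using u n by (intro eq_vecI) (auto simp: u1_def vec_first_def)
  show ?thesis
  proof
    show "(C *\<^sub>v u1) @\<^sub>v 0\<^sub>v l \<in> carrier_vec n" using C u1 n by auto
    show "((C *\<^sub>v u1) @\<^sub>v 0\<^sub>v l) $ r = 0" if "k \<le> r" "r < n" for r
      using that C u1 n by auto
    have "B1 *\<^sub>v (C *\<^sub>v u1) = u1"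
      using assoc_mult_mat_vec[OF S(1) C(1) u1, symmetric] C(2) u1 by simp
    moreover have "B *\<^sub>v ((C *\<^sub>v u1) @\<^sub>v 0\<^sub>v l) =
        (B1 *\<^sub>v (C *\<^sub>v u1) + B2 *\<^sub>v 0\<^sub>v l) @\<^sub>v (B3 *\<^sub>v (C *\<^sub>v u1) + B4 *\<^sub>v 0\<^sub>v l)"
      unfolding S(5) by (rule four_block_mat_mult_vec[OF S(1-4)]) (use C u1 in auto)
    moreover have "B2 *\<^sub>v 0\<^sub>v l = 0\<^sub>v k" "B4 *\<^sub>v 0\<^sub>v l = 0\<^sub>v l" "B3 *\<^sub>v (C *\<^sub>v u1) = 0\<^sub>v l"
      using S(2,4) B3 C u1 by (auto intro!: eq_vecI simp: scalar_prod_def)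
    ultimately show "B *\<^sub>v ((C *\<^sub>v u1) @\<^sub>v 0\<^sub>v l) = u"
      using u1 u_eq by auto
  qed
qed

lemma mat_diag_mult_vec:
  fixes f :: "nat \<Rightarrow> 'a :: semiring_0"
  assumes "x \<in> carrier_vec n"
  shows "mat_diag n f *\<^sub>v x = vec n (\<lambda>i. f i * x $ i)"
proof (rule eq_vecI)
  fix i assume "i < dim_vec (vec n (\<lambda>i. f i * x $ i))"
  then have i: "i < n" by simp
  have "(mat_diag n f *\<^sub>v x) $ i = (\<Sum>j<n. (if i = j then f j else 0) * x $ j)"
    using i assms by (simp add: mat_diag_def scalar_prod_def atLeast0LessThan)
  also have "\<dots> = (\<Sum>j<n. if i = j then f j * x $ j else 0)"
    by (intro sum.cong) auto
  also have "\<dots> = f i * x $ i" using i by simp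
  finally show "(mat_diag n f *\<^sub>v x) $ i = vec n (\<lambda>i. f i * x $ i) $ i" using i by simp
qed (auto simp: mat_diag_def)

text \<open>A common deflation of the pencil makes the span of the first \<open>k\<close> columns of \<open>Q\<close> a proper
  invariant subspace of \<open>mat_diag n z\<close>. It contains the cyclic vector \<open>col Q 0\<close>, and Lagrange
  polynomials in \<open>mat_diag n z\<close> turn this vector into multiples of all unit vectors.\<close>

lemma pencil_irreducible:
  assumes rel: "pencil_relation n z Q A B" and inj: "inj_on z {..<n}"
    and w: "\<And>j. j < n \<Longrightarrow> Q $$ (j, 0) \<noteq> 0" and k: "0 < k" "k < n"
    and A0: "\<And>r c. k \<le> r \<Longrightarrow> r < n \<Longrightarrow> c < k \<Longrightarrow> A $$ (r, c) = 0"
    and B0: "\<And>r c. k \<le> r \<Longrightarrow> r < n \<Longrightarrow> c < k \<Longrightarrow> B $$ (r, c) = 0"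
  shows False
proof -
  have Q: "unitary_mat n Q" and A: "A \<in> carrier_mat n n" and B: "B \<in> carrier_mat n n"
    and eq: "A = mat_adjoint Q * mat_diag n z * Q * B" and det: "det B \<noteq> 0"
    using rel by (auto simp: pencil_relation_def)
  note Q' = unitary_matD[OF Q]
  \<comment> \<open>The span of the first \<open>k\<close> columns of \<open>Q\<close>, described by
    the vanishing of the coordinates from index \<open>k\<close> on.\<close>
  define S where "S = {x \<in> carrier_vec n. \<forall>r. k \<le> r \<longrightarrow> r < n \<longrightarrow> (mat_adjoint Q *\<^sub>v x) $ r = 0}"
  \<comment> \<open>Invariance of \<open>S\<close> under the shifted diagonal matrix. A vector
    \<open>x\<close> of \<open>S\<close> equals \<open>Q * B\<close> applied to some
    \<open>u\<close> supported on the first \<open>k\<close> indices. The pencil relation turns the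
    coordinates of \<open>mat_diag n z *\<^sub>v x\<close> into \<open>A *\<^sub>v u\<close>, which
    has its support there as well.\<close>
  have step: "vec n (\<lambda>r. (z r - t) * x $ r) \<in> S" if x: "x \<in> S" for x t
  proof -
    have xc: "x \<in> carrier_vec n" and x0: "\<And>r. k \<le> r \<Longrightarrow> r < n \<Longrightarrow> (mat_adjoint Q *\<^sub>v x) $ r = 0"
      using x by (auto simp: S_def)
    have "mat_adjoint Q *\<^sub>v x \<in> carrier_vec n" using Q'(4) xc by simp
    then obtain u where u: "u \<in> carrier_vec n" "\<And>r. k \<le> r \<Longrightarrow> r < n \<Longrightarrow> u $ r = 0"
      "B *\<^sub>v u = mat_adjoint Q *\<^sub>v x"
      using block_upper_triangular_surj[OF B det k(2), of "mat_adjoint Q *\<^sub>v x"] B0 x0 by metis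
    have QQ: "Q *\<^sub>v (mat_adjoint Q *\<^sub>v x) = x"
      using assoc_mult_mat_vec[OF Q'(1,4) xc, symmetric] Q'(3) xc by simp
    have "A *\<^sub>v u = mat_adjoint Q *\<^sub>v (mat_diag n z *\<^sub>v (Q *\<^sub>v (B *\<^sub>v u)))"
      unfolding eq using Q' B u(1) by (simp add: assoc_mult_mat_vec[of _ n n _ n] mult_carrier_mat[of _ n n _ n])
    then have Au: "A *\<^sub>v u = mat_adjoint Q *\<^sub>v (mat_diag n z *\<^sub>v x)"
      using u(3) QQ by simp
    have Au0: "(A *\<^sub>v u) $ r = 0" if r: "k \<le> r" "r < n" for r
    proof -
      have "A $$ (r, c) * u $ c = 0" if "c < n" for c
        using that r A0[OF r] u(2) by (cases "c < k") auto
      then show ?thesis using r A u(1) by (auto simp: scalar_prod_def intro!: sum.neutral)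
    qed
    have split: "vec n (\<lambda>r. (z r - t) * x $ r) = mat_diag n z *\<^sub>v x - t \<cdot>\<^sub>v x"
      using xc by (auto simp: mat_diag_mult_vec[OF xc] algebra_simps)
    have "(mat_adjoint Q *\<^sub>v (mat_diag n z *\<^sub>v x - t \<cdot>\<^sub>v x)) $ r = 0" if r: "k \<le> r" "r < n" for r
    proof -
      have "mat_diag n z *\<^sub>v x \<in> carrier_vec n" using xc by (simp add: mat_diag_mult_vec)
      then have "mat_adjoint Q *\<^sub>v (mat_diag n z *\<^sub>v x - t \<cdot>\<^sub>v x)
          = A *\<^sub>v u - t \<cdot>\<^sub>v (mat_adjoint Q *\<^sub>v x)"
        using Q'(4) xc Au by (simp add: mult_minus_distrib_mat_vec[of _ n n] mult_mat_vec[of _ n n])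
      then show ?thesis using Au0[OF r] x0[OF r] r Q'(4) A by simp
    qed
    then show ?thesis unfolding S_def split using xc by (simp add: mat_diag_mult_vec)
  qed
  have lagrange: "finite L \<Longrightarrow> vec n (\<lambda>r. (\<Prod>l\<in>L. z r - z l) * Q $$ (r, 0)) \<in> S" for L
  proof (induction L rule: finite_induct)
    case empty
    have "(mat_adjoint Q *\<^sub>v vec n (\<lambda>r. Q $$ (r, 0))) $ r = 0" if r: "k \<le> r" "r < n" for r
    proof -
      have "(mat_adjoint Q *\<^sub>v vec n (\<lambda>r. Q $$ (r, 0))) $ r = (mat_adjoint Q * Q) $$ (r, 0)"
        using r k Q'(1,4) by (auto simp: scalar_prod_def intro!: sum.cong)
      then show ?thesis using r k Q'(2) by simp
    qed
    then show ?case by (simp add: S_def)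
  next
    case (insert l L)
    let ?x = "vec n (\<lambda>r. (\<Prod>l\<in>L. z r - z l) * Q $$ (r, 0))"
    have "vec n (\<lambda>r. (\<Prod>l\<in>insert l L. z r - z l) * Q $$ (r, 0)) = vec n (\<lambda>r. (z r - z l) * ?x $ r)"
      using insert.hyps by (intro eq_vecI) auto
    then show ?case using step[OF insert.IH, of "z l"] by simp
  qed
  \<comment> \<open>With all indices but \<open>j\<close> in the product, only component
    \<open>j\<close> survives, and it is nonzero by distinctness of the nodes and by
    \<open>w\<close>. So every unit vector lies in \<open>S\<close>, and row \<open>k\<close> of
    \<open>mat_adjoint Q\<close> is zero, which a unitary matrix does not allow.\<close>
  have zero: "mat_adjoint Q $$ (k, j) = 0" if j: "j < n" for j
  proof -
    let ?L = "{..<n} - {j}"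
    define p where "p = (\<Prod>l\<in>?L. z j - z l)"
    have p: "p \<noteq> 0" unfolding p_def using inj j by (auto simp: inj_on_def)
    have vanish: "(\<Prod>l\<in>?L. z r - z l) = 0" if "r < n" "r \<noteq> j" for r
      using that by (auto intro!: prod_zero bexI[of _ r])
    have "(mat_adjoint Q *\<^sub>v vec n (\<lambda>r. (\<Prod>l\<in>?L. z r - z l) * Q $$ (r, 0))) $ k = 0"
      using lagrange[of ?L] k by (simp add: S_def)
    moreover have "(mat_adjoint Q *\<^sub>v vec n (\<lambda>r. (\<Prod>l\<in>?L. z r - z l) * Q $$ (r, 0))) $ k
        = (\<Sum>r<n. mat_adjoint Q $$ (k, r) * ((\<Prod>l\<in>?L. z r - z l) * Q $$ (r, 0)))"
      using k Q'(4) by (auto simp: scalar_prod_def atLeast0LessThan intro!: sum.cong)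
    moreover have "\<dots> = (\<Sum>r<n. if r = j then mat_adjoint Q $$ (k, j) * (p * Q $$ (j, 0)) else 0)"
      using vanish by (intro sum.cong) (auto simp: p_def)
    ultimately show ?thesis using j p w[OF j] by simp
  qed
  have "(mat_adjoint Q * Q) $$ (k, k) = 0"
    using zero k Q'(1,4) by (auto simp: scalar_prod_def)
  then show False using Q'(2) k by simp
qed

section \<open>Regularity as invertibility of the second matrix of the pencil\<close>

lemma det_diff_smult_pencil:
  assumes Q: "unitary_mat n Q" and K: "K \<in> carrier_mat n n"
    and H: "mat_adjoint Q * mat_diag n z * Q * K = H"
  shows "det (H - x \<cdot>\<^sub>m K) =
    det (mat_adjoint Q) * det (mat_diag n (\<lambda>i. z i - x)) * det Q * det K"
proof -
  note Q' = unitary_matD[OF Q]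
  note assoc = assoc_mult_mat[of _ n n _ n _ n] mult_carrier_mat[of _ n n _ n]
  have QK: "Q * K \<in> carrier_mat n n" using Q' K by simp
  have D: "mat_diag n f * (Q * K) \<in> carrier_mat n n" for f
    using QK by (rule mult_carrier_mat[OF mat_diag_dim])
  \<comment> \<open>The shift by \<open>x\<close> is absorbed into the diagonal factor; together
    with the cancellation of \<open>mat_adjoint Q * Q\<close> this factors
    \<open>H - x \<cdot>\<^sub>m K\<close> completely.\<close>
  have shift: "mat_diag n (\<lambda>i. z i - x) * (Q * K) = mat_diag n z * (Q * K) - x \<cdot>\<^sub>m (Q * K)"
    unfolding mat_diag_mult_left[OF QK] using Q' K by (auto simp: algebra_simps)
  have "mat_adjoint Q * (mat_diag n (\<lambda>i. z i - x) * (Q * K))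
      = mat_adjoint Q * (mat_diag n z * (Q * K)) - x \<cdot>\<^sub>m (mat_adjoint Q * (Q * K))"
    unfolding shift
    using mult_minus_distrib_mat[OF Q'(4) D, of "x \<cdot>\<^sub>m (Q * K)"] mult_smult_distrib[OF Q'(4) QK] QK
    by simp
  also have "\<dots> = H - x \<cdot>\<^sub>m K"
    using H Q' K by (simp add: unitary_cancel[OF Q] assoc)
  finally have "H - x \<cdot>\<^sub>m K = mat_adjoint Q * (mat_diag n (\<lambda>i. z i - x) * (Q * K))" ..
  then show ?thesis
    using det_mult[OF Q'(4) D] det_mult[OF mat_diag_dim QK] det_mult[OF Q'(1) K] by simp
qed

lemma det_mat_diag_nonzero:
  fixes f :: "nat \<Rightarrow> complex"
  assumes "\<And>i. i < n \<Longrightarrow> f i \<noteq> 0"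
  shows "det (mat_diag n f) \<noteq> 0"
proof
  assume "det (mat_diag n f) = 0"
  then have "det (mat_diag n f * mat_diag n (\<lambda>i. inverse (f i))) = 0"
    using det_mult[OF mat_diag_dim[of n f] mat_diag_dim[of n "\<lambda>i. inverse (f i)"]] by simp
  moreover have "mat_diag n (\<lambda>i. f i * inverse (f i)) = 1\<^sub>m n"
    using assms by (intro eq_matI) (auto simp: mat_diag_def)
  ultimately show False by simp
qed

text \<open>By the factorization, \<open>det K = 0\<close> makes the pencil singular for every
  \<open>x\<close>, while for invertible \<open>K\<close> any \<open>x\<close> outside the finite
  set of nodes gives a nonzero determinant.\<close>

lemma regular_pencil_iff_det:
  assumes Q: "unitary_mat n Q" and K: "K \<in> carrier_mat n n"
    and H: "mat_adjoint Q * mat_diag n z * Q * K = H"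
  shows "regular_pencil H K \<longleftrightarrow> det K \<noteq> 0"
proof
  show "det K \<noteq> 0" if "regular_pencil H K"
    using that det_diff_smult_pencil[OF assms] by (auto simp: regular_pencil_def)
next
  assume det: "det K \<noteq> 0"
  obtain x where x: "x \<notin> z ` {..<n}"
    using ex_new_if_finite[OF infinite_UNIV_char_0] by (metis finite_imageI finite_lessThan)
  then have "det (mat_diag n (\<lambda>i. z i - x)) \<noteq> 0"
    by (intro det_mat_diag_nonzero) auto
  then show "regular_pencil H K"
    using det det_unitary_mat[OF Q] det_unitary_mat[OF unitary_mat_adjoint[OF Q]]
    by (auto simp: regular_pencil_def det_diff_smult_pencil[OF assms] intro!: exI[of _ x])
qed

section \<open>Plane rotations and poles\<close>

text \<open>An element of \<open>plane_rotations\<close> with its parameters exposed. The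
  normalization is left to \<open>plane_rotations_iff\<close>, so that the entry formulas hold for
  arbitrary \<open>a\<close> and \<open>b\<close>.\<close>

definition plane_rotation :: "nat \<Rightarrow> nat \<Rightarrow> complex \<Rightarrow> complex \<Rightarrow> complex mat" where
  "plane_rotation m i a b = mat (m + 1) (m + 1) (\<lambda>(r, c).
     if r = i \<and> c = i then cnj a
     else if r = i \<and> c = m then - cnj b
     else if r = m \<and> c = i then b
     else if r = m \<and> c = m then a
     else if r = c then 1 else 0)"

lemma plane_rotations_iff:
  "P \<in> plane_rotations m i \<longleftrightarrow>
     (\<exists>a b. P = plane_rotation m i a b \<and> cnj a * a + cnj b * b = 1)"
  by (auto simp: plane_rotations_def plane_rotation_def)

lemma plane_rotation_carrier [simp]: "plane_rotation m i a b \<in> carrier_mat (m + 1) (m + 1)"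
  by (simp add: plane_rotation_def)

lemma dim_plane_rotation [simp]:
  "dim_row (plane_rotation m i a b) = m + 1" "dim_col (plane_rotation m i a b) = m + 1"
  by (simp_all add: plane_rotation_def)

lemma index_plane_rotation:
  "r < m + 1 \<Longrightarrow> c < m + 1 \<Longrightarrow> plane_rotation m i a b $$ (r, c) =
    (if r = i \<and> c = i then cnj a
     else if r = i \<and> c = m then - cnj b
     else if r = m \<and> c = i then b
     else if r = m \<and> c = m then a
     else if r = c then 1 else 0)"
  by (simp add: plane_rotation_def)

lemma sum_two_indices:
  fixes f g :: "nat \<Rightarrow> 'a :: comm_monoid_add"
  assumes "i < n" "j < n" "i \<noteq> j"
  shows "(\<Sum>q<n. if q = i then f q else if q = j then g q else 0) = f i + g j"
proof -
  have "(\<Sum>q<n. if q = i then f q else if q = j then g q else 0)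
      = (\<Sum>q<n. (if q = i then f q else 0) + (if q = j then g q else 0))"
    using assms by (intro sum.cong) auto
  then show ?thesis using assms by (simp add: sum.distrib)
qed

lemma index_plane_rotation_mult:
  assumes A: "A \<in> carrier_mat (m + 1) n" and i: "i < m" and r: "r < m + 1" and c: "c < n"
  shows "(plane_rotation m i a b * A) $$ (r, c) =
    (if r = i then cnj a * A $$ (i, c) - cnj b * A $$ (m, c)
     else if r = m then b * A $$ (i, c) + a * A $$ (m, c) else A $$ (r, c))"
proof -
  let ?R = "plane_rotation m i a b"
  have eq: "(?R * A) $$ (r, c) = (\<Sum>q<m+1. ?R $$ (r, q) * A $$ (q, c))"
    using A r c by (simp add: scalar_prod_def atLeast0LessThan del: sum.lessThan_Suc)
  consider "r = i" | "r = m" | "r \<noteq> i" "r \<noteq> m" by blast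
  then show ?thesis
  proof cases
    case 1
    have "(\<Sum>q<m+1. ?R $$ (r, q) * A $$ (q, c)) = (\<Sum>q<m+1. if q = i then cnj a * A $$ (q, c)
        else if q = m then - cnj b * A $$ (q, c) else 0)"
      using 1 i by (intro sum.cong refl) (simp add: index_plane_rotation)
    then show ?thesis unfolding eq by (simp only:, subst sum_two_indices) (use 1 i in auto)
  next
    case 2
    have "(\<Sum>q<m+1. ?R $$ (r, q) * A $$ (q, c)) = (\<Sum>q<m+1. if q = i then b * A $$ (q, c)
        else if q = m then a * A $$ (q, c) else 0)"
      using 2 i by (intro sum.cong refl) (simp add: index_plane_rotation)
    then show ?thesis unfolding eq by (simp only:, subst sum_two_indices) (use 2 i in auto)
  next
    case 3
    have "(\<Sum>q<m+1. ?R $$ (r, q) * A $$ (q, c)) = (\<Sum>q<m+1. if q = r then A $$ (q, c) else 0)"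
      using 3 i r by (intro sum.cong refl) (simp add: index_plane_rotation)
    then show ?thesis using eq 3 r by (simp del: sum.lessThan_Suc)
  qed
qed

lemma index_mult_plane_rotation:
  assumes A: "A \<in> carrier_mat n (m + 1)" and i: "i < m" and r: "r < n" and c: "c < m + 1"
  shows "(A * plane_rotation m i a b) $$ (r, c) =
    (if c = i then cnj a * A $$ (r, i) + b * A $$ (r, m)
     else if c = m then a * A $$ (r, m) - cnj b * A $$ (r, i) else A $$ (r, c))"
proof -
  let ?R = "plane_rotation m i a b"
  have eq: "(A * ?R) $$ (r, c) = (\<Sum>q<m+1. A $$ (r, q) * ?R $$ (q, c))"
    using A r c by (simp add: scalar_prod_def atLeast0LessThan del: sum.lessThan_Suc)
  consider "c = i" | "c = m" | "c \<noteq> i" "c \<noteq> m" by blast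
  then show ?thesis
  proof cases
    case 1
    have "(\<Sum>q<m+1. A $$ (r, q) * ?R $$ (q, c)) = (\<Sum>q<m+1. if q = i then cnj a * A $$ (r, q)
        else if q = m then b * A $$ (r, q) else 0)"
      using 1 i by (intro sum.cong refl) (simp add: index_plane_rotation)
    then show ?thesis unfolding eq by (simp only:, subst sum_two_indices) (use 1 i in auto)
  next
    case 2
    have "(\<Sum>q<m+1. A $$ (r, q) * ?R $$ (q, c)) = (\<Sum>q<m+1. if q = i then - cnj b * A $$ (r, q)
        else if q = m then a * A $$ (r, q) else 0)"
      using 2 i by (intro sum.cong refl) (simp add: index_plane_rotation)
    then show ?thesis unfolding eq by (simp only:, subst sum_two_indices) (use 2 i in auto)
  next
    case 3
    have "(\<Sum>q<m+1. A $$ (r, q) * ?R $$ (q, c)) = (\<Sum>q<m+1. if q = c then A $$ (r, q) else 0)"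
      using 3 i c by (intro sum.cong refl) (simp add: index_plane_rotation)
    then show ?thesis using eq 3 c by (simp del: sum.lessThan_Suc)
  qed
qed

lemma mat_adjoint_plane_rotation:
  assumes "i < m"
  shows "mat_adjoint (plane_rotation m i a b) = plane_rotation m i (cnj a) (- b)"
proof (rule eq_matI)
  note adj = mat_adjoint_carrier[OF plane_rotation_carrier[of m i a b]]
  show "dim_row (mat_adjoint (plane_rotation m i a b)) = dim_row (plane_rotation m i (cnj a) (- b))"
    "dim_col (mat_adjoint (plane_rotation m i a b)) = dim_col (plane_rotation m i (cnj a) (- b))"
    using adj by auto
  fix r c
  assume "r < dim_row (plane_rotation m i (cnj a) (- b))" "c < dim_col (plane_rotation m i (cnj a) (- b))"
  then have rc: "r < m + 1" "c < m + 1" by auto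
  show "mat_adjoint (plane_rotation m i a b) $$ (r, c) = plane_rotation m i (cnj a) (- b) $$ (r, c)"
    unfolding index_mat_adjoint[OF plane_rotation_carrier rc]
    using rc assms by (simp add: index_plane_rotation)
qed

lemma plane_rotation_mult_inverse:
  assumes "i < m" "cnj a * a + cnj b * b = 1"
  shows "plane_rotation m i a b * plane_rotation m i (cnj a) (- b) = 1\<^sub>m (m + 1)"
proof (rule eq_matI)
  fix r c
  assume "r < dim_row (1\<^sub>m (m + 1) :: complex mat)" "c < dim_col (1\<^sub>m (m + 1) :: complex mat)"
  then have rc: "r < m + 1" "c < m + 1" by auto
  show "(plane_rotation m i a b * plane_rotation m i (cnj a) (- b)) $$ (r, c) = 1\<^sub>m (m + 1) $$ (r, c)"
    unfolding index_plane_rotation_mult[OF plane_rotation_carrier assms(1) rc]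
    using rc assms by (auto simp: index_plane_rotation algebra_simps)
qed auto

lemma unitary_mat_plane_rotation:
  assumes "i < m" "P \<in> plane_rotations m i"
  shows "unitary_mat (m + 1) P"
proof -
  obtain a b where P: "P = plane_rotation m i a b" and ab: "cnj a * a + cnj b * b = 1"
    using assms by (auto simp: plane_rotations_iff)
  have "P * mat_adjoint P = 1\<^sub>m (m + 1)"
    using plane_rotation_mult_inverse[OF assms(1) ab] assms(1) P
    by (simp add: mat_adjoint_plane_rotation)
  moreover have "mat_adjoint P * P = 1\<^sub>m (m + 1)"
    using plane_rotation_mult_inverse[OF assms(1), of "cnj a" "- b"] assms(1) P ab
    by (simp add: mat_adjoint_plane_rotation mult.commute)
  ultimately show ?thesis using P plane_rotation_carrier[of m i a b] by (simp add: unitary_mat_def)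
qed

text \<open>Dividing \<open>x\<close> and \<open>- y\<close> by the Euclidean norm of the pair gives
  \<open>a\<close> and \<open>b\<close>; the surviving component is then the norm itself. For the
  zero pair the identity serves. The nonvanishing component is what later keeps the pencil
  proper.\<close>

lemma exists_annihilating_rotation:
  fixes x y :: complex
  obtains a b where "cnj a * a + cnj b * b = 1" "b * x + a * y = 0"
    "x \<noteq> 0 \<or> y \<noteq> 0 \<Longrightarrow> cnj a * x - cnj b * y \<noteq> 0"
proof (cases "x = 0 \<and> y = 0")
  case True
  then show ?thesis using that[of 1 0] by simp
next
  case False
  define \<rho> where "\<rho> = sqrt ((cmod x)\<^sup>2 + (cmod y)\<^sup>2)"
  have pos: "0 < (cmod x)\<^sup>2 + (cmod y)\<^sup>2"
    using False by (metis sum_power2_gt_zero_iff norm_eq_zero)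
  have \<rho>: "\<rho> \<noteq> 0" using False by (simp add: \<rho>_def)
  have sq: "cnj x * x + cnj y * y = complex_of_real \<rho> * complex_of_real \<rho>"
  proof -
    have "\<rho> * \<rho> = (cmod x)\<^sup>2 + (cmod y)\<^sup>2" using pos by (simp add: \<rho>_def)
    then have "complex_of_real \<rho> * complex_of_real \<rho> = complex_of_real ((cmod x)\<^sup>2 + (cmod y)\<^sup>2)"
      by (metis of_real_mult)
    then show ?thesis
      unfolding of_real_add complex_norm_square by (simp add: mult.commute)
  qed
  show ?thesis
  proof (rule that[of "x / \<rho>" "- y / \<rho>"])
    show "cnj (x / \<rho>) * (x / \<rho>) + cnj (- y / \<rho>) * (- y / \<rho>) = 1"
      using sq \<rho> by (simp add: add_divide_distrib[symmetric])
    show "- y / \<rho> * x + x / \<rho> * y = 0" by simp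
    have "cnj (x / \<rho>) * x - cnj (- y / \<rho>) * y = (cnj x * x + cnj y * y) / \<rho>"
      by (simp add: add_divide_distrib)
    then show "cnj (x / \<rho>) * x - cnj (- y / \<rho>) * y \<noteq> 0" using sq \<rho> by simp
  qed
qed

text \<open>As \<open>ext_ratio 0 0\<close> is \<open>None\<close>, the ratio alone would accept a
  zero pair as a pole at infinity. Joined with the properness condition, a pole becomes a property
  of a single pair of entries.\<close>

definition has_pole :: "complex option \<Rightarrow> complex \<Rightarrow> complex \<Rightarrow> bool" where
  "has_pole \<xi> h k \<longleftrightarrow> \<not> (h = 0 \<and> k = 0) \<and> ext_ratio h k = \<xi>"

text \<open>A pole is a point of the projective line with homogeneous coordinates \<mu> and \<nu>.
  Finite and infinite poles are thereby treated alike, and being proportional to the coordinates is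
  a linear condition on the pair of entries.\<close>

lemma has_pole_homogeneous:
  obtains \<mu> \<nu> where "\<mu> \<noteq> 0 \<or> \<nu> \<noteq> 0"
    "\<And>h k. has_pole \<xi> h k \<longleftrightarrow> (\<exists>s. s \<noteq> 0 \<and> h = s * \<mu> \<and> k = s * \<nu>)"
proof (cases \<xi>)
  case None
  show ?thesis
    by (rule that[of 1 0]) (auto simp: None has_pole_def ext_ratio_def)
next
  case (Some x)
  show ?thesis
    by (rule that[of x 1]) (auto simp: Some has_pole_def ext_ratio_def)
qed

section \<open>Chasing the last row\<close>

text \<open>The pencil after the row rotations \<open>0, \<dots>, i\<close> and the column rotations \<open>0, \<dots>, i - 1\<close>:
  the leading \<open>m \<times> m\<close> block keeps its Hessenberg form and poles, the last row has been cleared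
  before column \<open>i\<close>, and the last column has not been filled between the rows \<open>i\<close> and \<open>m\<close>.\<close>

definition chased :: "nat \<Rightarrow> (nat \<Rightarrow> complex) \<Rightarrow> (nat \<Rightarrow> complex option) \<Rightarrow> complex vec \<Rightarrow> nat \<Rightarrow>
    complex mat \<Rightarrow> complex mat \<Rightarrow> complex mat \<Rightarrow> bool" where
  "chased m z \<xi> w i Q A B \<longleftrightarrow> pencil_relation (m + 1) z Q A B \<and> col Q 0 = w \<and>
     (\<forall>r<m. \<forall>c<m. c + 1 < r \<longrightarrow> A $$ (r, c) = 0 \<and> B $$ (r, c) = 0) \<and>
     (\<forall>c. c + 1 < m \<longrightarrow> has_pole (\<xi> c) (A $$ (c + 1, c)) (B $$ (c + 1, c))) \<and>
     (\<forall>r<m. i < r \<longrightarrow> A $$ (r, m) = 0 \<and> B $$ (r, m) = 0) \<and>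
     (\<forall>c<i. A $$ (m, c) = 0 \<and> B $$ (m, c) = 0)"

text \<open>The rotation turns the pair of entries at \<open>(m, i)\<close> into the direction of
  \<open>\<xi> i\<close>, and the pair at \<open>(i + 1, i)\<close> keeps this direction. Only the
  multiples \<open>t\<close> and \<open>s\<close> remain open, and if both vanished the pencil would
  deflate. For \<open>i + 1 = m\<close> there is no separate subdiagonal row: \<open>s\<close> is
  then arbitrary and the final disjunction reduces to \<open>t \<noteq> 0\<close>.\<close>

lemma chased_column_step:
  assumes ch: "chased m z \<xi> w i Q A B" and i: "i < m" and inj: "inj_on z {..<m + 1}"
    and w: "\<forall>j<m + 1. w $ j \<noteq> 0"
    and \<mu>\<nu>: "\<mu> \<noteq> 0 \<or> \<nu> \<noteq> 0"
    and pole: "\<And>h k. has_pole (\<xi> i) h k \<longleftrightarrow> (\<exists>s. s \<noteq> 0 \<and> h = s * \<mu> \<and> k = s * \<nu>)"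
  shows "\<exists>R s t. R \<in> plane_rotations m i \<and> pencil_relation (m + 1) z Q (A * R) (B * R) \<and>
    (\<forall>r<m + 1. \<forall>c<m. c \<noteq> i \<longrightarrow>
       (A * R) $$ (r, c) = A $$ (r, c) \<and> (B * R) $$ (r, c) = B $$ (r, c)) \<and>
    (\<forall>r<m. i + 1 < r \<longrightarrow> (A * R) $$ (r, i) = 0 \<and> (B * R) $$ (r, i) = 0 \<and>
       (A * R) $$ (r, m) = 0 \<and> (B * R) $$ (r, m) = 0) \<and>
    (A * R) $$ (m, i) = t * \<mu> \<and> (B * R) $$ (m, i) = t * \<nu> \<and>
    (i + 1 < m \<longrightarrow> (A * R) $$ (i + 1, i) = s * \<mu> \<and> (B * R) $$ (i + 1, i) = s * \<nu>) \<and>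
    (i + 1 < m \<and> s \<noteq> 0 \<or> t \<noteq> 0)"
proof -
  have rel: "pencil_relation (m + 1) z Q A B" and Q0: "col Q 0 = w"
    and hess: "\<And>r c. r < m \<Longrightarrow> c < m \<Longrightarrow> c + 1 < r \<Longrightarrow> A $$ (r, c) = 0 \<and> B $$ (r, c) = 0"
    and poles: "\<And>c. c + 1 < m \<Longrightarrow> has_pole (\<xi> c) (A $$ (c + 1, c)) (B $$ (c + 1, c))"
    and lastcol: "\<And>r. r < m \<Longrightarrow> i < r \<Longrightarrow> A $$ (r, m) = 0 \<and> B $$ (r, m) = 0"
    and lastrow: "\<And>c. c < i \<Longrightarrow> A $$ (m, c) = 0 \<and> B $$ (m, c) = 0"
    using ch unfolding chased_def by auto
  have Q: "unitary_mat (m + 1) Q" and A: "A \<in> carrier_mat (m + 1) (m + 1)"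
    and B: "B \<in> carrier_mat (m + 1) (m + 1)"
    using rel by (auto simp: pencil_relation_def)
  \<comment> \<open>Proportionality of the new pair at \<open>(m, i)\<close> to \<mu>, \<nu> is one
    linear equation in the coefficients of the rotated column. These coefficients are
    \<open>cnj a\<close> and \<open>b\<close>, hence the conjugation between \<open>a'\<close> and
    \<open>a\<close>.\<close>
  obtain b a' where unit: "cnj a' * a' + cnj b * b = 1"
    and ann: "b * (\<nu> * A $$ (m, m) - \<mu> * B $$ (m, m)) + a' * (\<nu> * A $$ (m, i) - \<mu> * B $$ (m, i)) = 0"
    using exists_annihilating_rotation by metis
  define a where "a = cnj a'"
  define R where "R = plane_rotation m i a b"
  have R: "R \<in> plane_rotations m i"
    unfolding plane_rotations_iff R_def a_def
    using unit by (intro exI[of _ "cnj a'"] exI[of _ b]) (simp add: mult.commute)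
  note idx = index_mult_plane_rotation[OF A i, of _ _ a b, folded R_def]
    index_mult_plane_rotation[OF B i, of _ _ a b, folded R_def]
  have relR: "pencil_relation (m + 1) z Q (A * R) (B * R)"
    using pencil_relation_mult_right[OF rel unitary_mat_plane_rotation[OF i R]] .
  have same: "(A * R) $$ (r, c) = A $$ (r, c) \<and> (B * R) $$ (r, c) = B $$ (r, c)"
    if "r < m + 1" "c < m" "c \<noteq> i" for r c
    using that by (simp add: idx)
  have coli: "(A * R) $$ (r, i) = 0 \<and> (B * R) $$ (r, i) = 0" if "r < m" "i + 1 < r" for r
    using that i hess[of r i] lastcol[of r] by (simp add: idx)
  have colm: "(A * R) $$ (r, m) = 0 \<and> (B * R) $$ (r, m) = 0" if "r < m" "i + 1 < r" for r
    using that i hess[of r i] lastcol[of r] by (simp add: idx)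
  have "\<nu> * (A * R) $$ (m, i) = \<mu> * (B * R) $$ (m, i)"
    using ann i by (simp add: idx a_def algebra_simps)
  then have "\<exists>t. (A * R) $$ (m, i) = t * \<mu> \<and> (B * R) $$ (m, i) = t * \<nu>"
  proof (cases "\<mu> = 0")
    case True
    then show ?thesis
      using \<open>\<nu> * (A * R) $$ (m, i) = \<mu> * (B * R) $$ (m, i)\<close> \<mu>\<nu>
      by (intro exI[of _ "(B * R) $$ (m, i) / \<nu>"]) auto
  next
    case False
    then show ?thesis
      using \<open>\<nu> * (A * R) $$ (m, i) = \<mu> * (B * R) $$ (m, i)\<close>
      by (intro exI[of _ "(A * R) $$ (m, i) / \<mu>"]) (auto simp: field_simps)
  qed
  then obtain t where t: "(A * R) $$ (m, i) = t * \<mu>" "(B * R) $$ (m, i) = t * \<nu>" by blast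
  have "\<exists>s. i + 1 < m \<longrightarrow> (A * R) $$ (i + 1, i) = s * \<mu> \<and> (B * R) $$ (i + 1, i) = s * \<nu>"
  proof (cases "i + 1 < m")
    case True
    \<comment> \<open>The last column is zero in row \<open>i + 1\<close>, so the rotation merely
      scales this pair by \<open>cnj a\<close>, a factor that may be zero.\<close>
    obtain s0 where "A $$ (i + 1, i) = s0 * \<mu>" "B $$ (i + 1, i) = s0 * \<nu>"
      using poles[OF True] pole by blast
    then show ?thesis
      using True i lastcol[of "i + 1"] by (intro exI[of _ "cnj a * s0"]) (simp add: idx)
  qed simp
  then obtain s where s: "i + 1 < m \<Longrightarrow> (A * R) $$ (i + 1, i) = s * \<mu> \<and> (B * R) $$ (i + 1, i) = s * \<nu>"
    by blast
  \<comment> \<open>Otherwise both matrices vanish in the rows from \<open>i + 1\<close> on and the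
    columns up to \<open>i\<close>: earlier columns by the Hessenberg shape and the cleared last
    row, column \<open>i\<close> by assumption. This contradicts irreducibility.\<close>
  have "i + 1 < m \<and> s \<noteq> 0 \<or> t \<noteq> 0"
  proof (rule ccontr)
    assume neg: "\<not> (i + 1 < m \<and> s \<noteq> 0 \<or> t \<noteq> 0)"
    have zero: "(A * R) $$ (r, c) = 0 \<and> (B * R) $$ (r, c) = 0"
      if rc: "i + 1 \<le> r" "r < m + 1" "c < i + 1" for r c
    proof (cases "c = i")
      case True
      consider "r = m" | "r < m" "r = i + 1" | "r < m" "i + 1 < r" using rc by linarith
      then show ?thesis
      proof cases
        case 1 then show ?thesis using True t neg by simp
      next
        case 2 then show ?thesis using True s neg by simp
      next
        case 3 then show ?thesis using True coli by simp
      qed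
    next
      case False
      then have c: "c < i" using rc by simp
      then have "A $$ (r, c) = 0 \<and> B $$ (r, c) = 0"
        using rc i hess[of r c] lastrow[of c] by (cases "r = m") auto
      then show ?thesis using same[of r c] rc c i by simp
    qed
    have "Q $$ (j, 0) \<noteq> 0" if "j < m + 1" for j
    proof -
      have "Q $$ (j, 0) = col Q 0 $ j"
        using that unitary_matD(1)[OF Q] by auto
      then show ?thesis using that w Q0 by simp
    qed
    then show False
      using pencil_irreducible[OF relR inj, of "i + 1"] zero i by simp
  qed
  then show ?thesis
    using R relR same coli colm t s by (intro exI[of _ R] exI[of _ s] exI[of _ t]) simp
qed

text \<open>After the column rotation, the pairs at \<open>(i + 1, i)\<close> and
  \<open>(m, i)\<close> are multiples of the same \<mu>, \<nu>. A row rotation that annihilates the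
  second component of \<open>(s, t)\<close> therefore clears \<open>(m, i)\<close> in both matrices
  at once and leaves a nonzero multiple, hence the pole \<open>\<xi> i\<close>, on the
  subdiagonal.\<close>

lemma chased_step:
  assumes ch: "chased m z \<xi> w i Q A B" and i: "i + 1 < m" and inj: "inj_on z {..<m + 1}"
    and w: "\<forall>j<m + 1. w $ j \<noteq> 0"
  obtains R P where "R \<in> plane_rotations m i" "P \<in> plane_rotations m (i + 1)"
    "chased m z \<xi> w (i + 1) (Q * mat_adjoint P) (P * (A * R)) (P * (B * R))"
proof -
  obtain \<mu> \<nu> where \<mu>\<nu>: "\<mu> \<noteq> 0 \<or> \<nu> \<noteq> 0"
    and pole: "\<And>h k. has_pole (\<xi> i) h k \<longleftrightarrow> (\<exists>s. s \<noteq> 0 \<and> h = s * \<mu> \<and> k = s * \<nu>)"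
    using has_pole_homogeneous[of "\<xi> i"] by blast
  have i': "i < m" using i by simp
  obtain R s t where R: "R \<in> plane_rotations m i"
    and rel: "pencil_relation (m + 1) z Q (A * R) (B * R)"
    and same: "\<forall>r<m + 1. \<forall>c<m. c \<noteq> i \<longrightarrow>
       (A * R) $$ (r, c) = A $$ (r, c) \<and> (B * R) $$ (r, c) = B $$ (r, c)"
    and low: "\<forall>r<m. i + 1 < r \<longrightarrow> (A * R) $$ (r, i) = 0 \<and> (B * R) $$ (r, i) = 0 \<and>
       (A * R) $$ (r, m) = 0 \<and> (B * R) $$ (r, m) = 0"
    and t: "(A * R) $$ (m, i) = t * \<mu>" "(B * R) $$ (m, i) = t * \<nu>"
    and s: "(A * R) $$ (i + 1, i) = s * \<mu>" "(B * R) $$ (i + 1, i) = s * \<nu>"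
    and st: "s \<noteq> 0 \<or> t \<noteq> 0"
    using chased_column_step[OF ch i' inj w \<mu>\<nu> pole] i by blast
  have Q0: "col Q 0 = w"
    and hess: "\<And>r c. r < m \<Longrightarrow> c < m \<Longrightarrow> c + 1 < r \<Longrightarrow> A $$ (r, c) = 0 \<and> B $$ (r, c) = 0"
    and poles: "\<And>c. c + 1 < m \<Longrightarrow> has_pole (\<xi> c) (A $$ (c + 1, c)) (B $$ (c + 1, c))"
    and lastrow: "\<And>c. c < i \<Longrightarrow> A $$ (m, c) = 0 \<and> B $$ (m, c) = 0"
    using ch unfolding chased_def by auto
  have Q: "Q \<in> carrier_mat (m + 1) (m + 1)"
    and A: "A * R \<in> carrier_mat (m + 1) (m + 1)" and B: "B * R \<in> carrier_mat (m + 1) (m + 1)"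
    using rel by (auto simp: pencil_relation_def unitary_mat_def)
  obtain a b where unit: "cnj a * a + cnj b * b = 1" and ann: "b * s + a * t = 0"
    and nz: "cnj a * s - cnj b * t \<noteq> 0"
    using exists_annihilating_rotation[of s t] st by metis
  define P where "P = plane_rotation m (i + 1) a b"
  have P: "P \<in> plane_rotations m (i + 1)"
    using unit by (auto simp: plane_rotations_iff P_def)
  note idx = index_plane_rotation_mult[OF A i, of _ _ a b, folded P_def]
    index_plane_rotation_mult[OF B i, of _ _ a b, folded P_def]
  have adj: "mat_adjoint P = plane_rotation m (i + 1) (cnj a) (- b)"
    using i by (simp add: P_def mat_adjoint_plane_rotation)
  have relP: "pencil_relation (m + 1) z (Q * mat_adjoint P) (P * (A * R)) (P * (B * R))"
    using pencil_relation_mult_left[OF rel unitary_mat_plane_rotation[OF i P]] .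
  \<comment> \<open>\<open>P\<close> acts on the indices \<open>i + 1\<close> and \<open>m\<close>,
    both positive, so the first column of \<open>Q\<close> stays fixed.\<close>
  have "col (Q * mat_adjoint P) 0 = w"
  proof (rule eq_vecI)
    show "dim_vec (col (Q * mat_adjoint P) 0) = dim_vec w" using Q Q0 by auto
    fix r assume "r < dim_vec w"
    then have r: "r < m + 1" using Q Q0 by auto
    have "col (Q * mat_adjoint P) 0 $ r = (Q * mat_adjoint P) $$ (r, 0)"
      using Q r by (simp add: adj del: index_mult_mat(1))
    also have "\<dots> = Q $$ (r, 0)"
      using index_mult_plane_rotation[OF Q i r, of 0 "cnj a" "- b"] adj i by simp
    also have "\<dots> = w $ r" using Q0 Q r by auto
    finally show "col (Q * mat_adjoint P) 0 $ r = w $ r" .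
  qed
  moreover have "(P * (A * R)) $$ (r, c) = 0 \<and> (P * (B * R)) $$ (r, c) = 0"
    if "r < m" "c < m" "c + 1 < r" for r c
  proof (cases "r = i + 1")
    \<comment> \<open>Mixing the rows \<open>i + 1\<close> and \<open>m\<close> causes no fill-in
      left of column \<open>i\<close>, since both are already zero there.\<close>
    case True
    then have "c < i" using that by simp
    then show ?thesis
      using that True same[rule_format, of r c] same[rule_format, of m c] hess[of r c] lastrow[of c] by (simp add: idx)
  next
    case False
    then show ?thesis
      using that same[rule_format, of r c] hess[of r c] low[rule_format, of r] by (cases "c = i") (auto simp: idx)
  qed
  moreover have "has_pole (\<xi> c) ((P * (A * R)) $$ (c + 1, c)) ((P * (B * R)) $$ (c + 1, c))"
    if c: "c + 1 < m" for c
  proof (cases "c = i")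
    case True
    have "(P * (A * R)) $$ (i + 1, i) = (cnj a * s - cnj b * t) * \<mu>"
      "(P * (B * R)) $$ (i + 1, i) = (cnj a * s - cnj b * t) * \<nu>"
      using i s t by (simp_all add: idx algebra_simps)
    then show ?thesis using nz True pole by blast
  next
    case False
    then show ?thesis using c poles[OF c] same[rule_format, of "c + 1" c] by (simp add: idx)
  qed
  \<comment> \<open>Fill-in of the last column descends at most to row \<open>i + 1\<close>, which
    the strict inequality excludes at the new index.\<close>
  moreover have "(P * (A * R)) $$ (r, m) = 0 \<and> (P * (B * R)) $$ (r, m) = 0"
    if "r < m" "i + 1 < r" for r
    using that low[rule_format, OF that] by (simp add: idx)
  moreover have "(P * (A * R)) $$ (m, c) = 0 \<and> (P * (B * R)) $$ (m, c) = 0" if "c < i + 1" for c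
  proof (cases "c = i")
    case True
    have "(P * (A * R)) $$ (m, i) = (b * s + a * t) * \<mu>"
      "(P * (B * R)) $$ (m, i) = (b * s + a * t) * \<nu>"
      using i s t by (simp_all add: idx algebra_simps)
    then show ?thesis using ann True by simp
  next
    case False
    then have "c < i" using that by simp
    then show ?thesis
      using i same[rule_format, of "i + 1" c] same[rule_format, of m c] hess[of "i + 1" c] lastrow[of c] by (simp add: idx)
  qed
  ultimately have "chased m z \<xi> w (i + 1) (Q * mat_adjoint P) (P * (A * R)) (P * (B * R))"
    using relP unfolding chased_def by blast
  from that[OF R P this] show ?thesis .
qed

section \<open>Bordering\<close>

lemma border_mat_carrier: "A \<in> carrier_mat n n \<Longrightarrow> border_mat A x \<in> carrier_mat (n + 1) (n + 1)"
  by (auto simp: border_mat_def Let_def)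

lemma border_mat_eq_four_block:
  "A \<in> carrier_mat n n \<Longrightarrow> border_mat A x = four_block_mat A (0\<^sub>m n 1) (0\<^sub>m 1 n) (mat 1 1 (\<lambda>_. x))"
  by (simp add: border_mat_def Let_def diag_block_mat.simps(2)[of A] del: diag_block_mat.simps)

lemma index_border_mat:
  assumes "A \<in> carrier_mat n n" "r < n + 1" "c < n + 1"
  shows "border_mat A x $$ (r, c) =
    (if r < n \<and> c < n then A $$ (r, c) else if r = n \<and> c = n then x else 0)"
  using assms by (auto simp: border_mat_eq_four_block)

lemma border_mat_mult:
  assumes A: "A \<in> carrier_mat n n" and B: "B \<in> carrier_mat n n"
  shows "border_mat A x * border_mat B y = border_mat (A * B) (x * y)"
proof -
  have "mat 1 1 (\<lambda>_. x) * mat 1 1 (\<lambda>_. y) = mat 1 1 (\<lambda>_. x * y)"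
    by (rule eq_matI) (auto simp: scalar_prod_def)
  moreover have "A * B \<in> carrier_mat n n" using A B by simp
  ultimately show ?thesis
    unfolding border_mat_eq_four_block[OF A] border_mat_eq_four_block[OF B]
      border_mat_eq_four_block[OF \<open>A * B \<in> carrier_mat n n\<close>]
    by (subst mult_four_block_mat[of _ n n _ 1 _ 1 _ _ n _ 1]) (use A B in auto)
qed

lemma mat_adjoint_border_mat:
  assumes A: "A \<in> carrier_mat n n"
  shows "mat_adjoint (border_mat A x) = border_mat (mat_adjoint A) (cnj x)"
proof (rule eq_matI)
  note bA = border_mat_carrier[OF A, of x] and aA = mat_adjoint_carrier[OF A]
  note car = mat_adjoint_carrier[OF bA] border_mat_carrier[OF aA, of "cnj x"]
  show "dim_row (mat_adjoint (border_mat A x)) = dim_row (border_mat (mat_adjoint A) (cnj x))"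
    "dim_col (mat_adjoint (border_mat A x)) = dim_col (border_mat (mat_adjoint A) (cnj x))"
    using car by auto
  fix i j
  assume "i < dim_row (border_mat (mat_adjoint A) (cnj x))"
    "j < dim_col (border_mat (mat_adjoint A) (cnj x))"
  then have ij: "i < n + 1" "j < n + 1" using car by auto
  show "mat_adjoint (border_mat A x) $$ (i, j) = border_mat (mat_adjoint A) (cnj x) $$ (i, j)"
    unfolding index_mat_adjoint[OF bA ij] index_border_mat[OF A ij(2,1)] index_border_mat[OF aA ij]
    by (auto simp: index_mat_adjoint[OF A])
qed

lemma border_mat_one: "border_mat (1\<^sub>m n) 1 = 1\<^sub>m (n + 1)"
  using border_mat_carrier[of "1\<^sub>m n" n 1]
  by (intro eq_matI) (auto simp: index_border_mat[of _ n] simp flip: One_nat_def)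

lemma border_mat_diag: "border_mat (mat_diag n z) (z n) = mat_diag (n + 1) z"
proof (rule eq_matI)
  fix i j
  assume "i < dim_row (mat_diag (n + 1) z)" "j < dim_col (mat_diag (n + 1) z)"
  then have ij: "i < n + 1" "j < n + 1" by (auto simp: mat_diag_def)
  show "border_mat (mat_diag n z) (z n) $$ (i, j) = mat_diag (n + 1) z $$ (i, j)"
    unfolding index_border_mat[OF mat_diag_dim ij] using ij by (auto simp: mat_diag_def)
qed (use border_mat_carrier[OF mat_diag_dim, of n z "z n"] in \<open>auto simp: mat_diag_def\<close>)

lemma det_border_mat:
  fixes A :: "complex mat"
  assumes "A \<in> carrier_mat n n"
  shows "det (border_mat A x) = det A * x"
  using det_four_block_mat_lower_left_zero[OF assms, of "0\<^sub>m n 1" 1 "0\<^sub>m 1 n" "mat 1 1 (\<lambda>_. x)"]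
  by (simp add: border_mat_eq_four_block[OF assms] det_single)

text \<open>All matrices are block diagonal, and in the added block the relation reads
  \<open>z n * k = h\<close>. The determinant of the second matrix gains the factor
  \<open>k\<close>.\<close>

lemma pencil_relation_border:
  assumes rel: "pencil_relation n z Q H K" and "z n * k = h" "k \<noteq> 0"
  shows "pencil_relation (n + 1) z (border_mat Q 1) (border_mat H h) (border_mat K k)"
proof -
  have Q: "unitary_mat n Q" and H: "H \<in> carrier_mat n n" and K: "K \<in> carrier_mat n n"
    and eq: "mat_adjoint Q * mat_diag n z * Q * K = H" and det: "det K \<noteq> 0"
    using rel by (auto simp: pencil_relation_def)
  note Q' = unitary_matD[OF Q]
  have Z: "mat_adjoint Q * mat_diag n z \<in> carrier_mat n n"
    using Q'(4) by (rule mult_carrier_mat) simp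
  have "unitary_mat (n + 1) (border_mat Q 1)"
    using Q' border_mat_carrier[OF Q'(1), of 1]
    by (simp add: unitary_mat_def mat_adjoint_border_mat border_mat_mult[of _ n] border_mat_one)
  moreover have "mat_adjoint (border_mat Q 1) * mat_diag (n + 1) z * border_mat Q 1 * border_mat K k
      = border_mat H h"
    unfolding mat_adjoint_border_mat[OF Q'(1)] border_mat_diag[symmetric]
      border_mat_mult[OF Q'(4) mat_diag_dim] border_mat_mult[OF Z Q'(1)]
      border_mat_mult[OF mult_carrier_mat[OF Z Q'(1)] K] eq
    using assms(2) by simp
  ultimately show ?thesis
    using border_mat_carrier[OF H, of h] border_mat_carrier[OF K, of k] det assms(3)
    by (simp add: pencil_relation_def det_border_mat[OF K])
qed

section \<open>Products of rotations and the full chase\<close>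

lemma plane_rotations_carrier:
  "P \<in> plane_rotations m i \<Longrightarrow> P \<in> carrier_mat (m + 1) (m + 1)"
  by (auto simp: plane_rotations_def)

lemma plane_rotations_list_carrier:
  assumes "\<forall>j<length As. As ! j \<in> plane_rotations m j"
  shows "set As \<subseteq> carrier_mat (m + 1) (m + 1)"
  unfolding set_conv_nth using assms plane_rotations_carrier by blast

lemma mat_prod_list_simps:
  "mat_prod_list n [] = 1\<^sub>m n" "mat_prod_list n (A # As) = A * mat_prod_list n As"
  by (simp_all add: mat_prod_list_def)

lemma mat_prod_list_carrier:
  "set As \<subseteq> carrier_mat n n \<Longrightarrow> mat_prod_list n As \<in> carrier_mat n n"
  by (induction As) (auto simp: mat_prod_list_simps intro!: mult_carrier_mat)

lemma mat_prod_list_snoc: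
  assumes "set As \<subseteq> carrier_mat n n" "X \<in> carrier_mat n n"
  shows "mat_prod_list n (As @ [X]) = mat_prod_list n As * X"
  using assms
proof (induction As)
  case (Cons A As)
  have A: "A \<in> carrier_mat n n" and As: "mat_prod_list n As \<in> carrier_mat n n"
    using Cons.prems(1) by (auto intro!: mat_prod_list_carrier)
  show ?case
    using Cons assoc_mult_mat[OF A As Cons.prems(2)] by (simp add: mat_prod_list_simps)
qed (simp add: mat_prod_list_simps)

lemma mat_adjoint_mat_prod_list:
  fixes As :: "complex mat list"
  assumes "set As \<subseteq> carrier_mat n n"
  shows "mat_adjoint (mat_prod_list n As) = mat_prod_list n (map mat_adjoint (rev As))"
  using assms
proof (induction As)
  case Nil
  show ?case
    using unitary_matD(2)[OF unitary_mat_one, of n] unitary_matD(4)[OF unitary_mat_one, of n]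
    by (simp add: mat_prod_list_simps)
next
  case (Cons A As)
  have A: "A \<in> carrier_mat n n" and As: "mat_prod_list n As \<in> carrier_mat n n"
    using Cons.prems(1) by (auto intro!: mat_prod_list_carrier)
  have adj: "set (map mat_adjoint (rev As)) \<subseteq> carrier_mat n n"
    using Cons.prems by (auto intro!: mat_adjoint_carrier)
  show ?case
    using Cons mat_prod_list_snoc[OF adj mat_adjoint_carrier[OF A]]
    by (simp add: mat_prod_list_simps mat_adjoint_mult[OF A As])
qed

section \<open>Beginning, iteration and end of the chase\<close>

lemma border_col_rotation:
  assumes Q: "unitary_mat m Q" and m: "m \<ge> 1" and v: "\<forall>i<m + 1. v i \<noteq> 0"
    and col: "col Q 0 = vec m (\<lambda>i. v i / complex_of_real (L2_set (\<lambda>j. cmod (v j)) {..<m}))"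
  obtains P where "P \<in> plane_rotations m 0"
    "col (border_mat Q 1 * mat_adjoint P) 0 =
       vec (m + 1) (\<lambda>i. v i / complex_of_real (L2_set (\<lambda>j. cmod (v j)) {..<m + 1}))"
proof -
  define N0 where "N0 = L2_set (\<lambda>j. cmod (v j)) {..<m}"
  define N1 where "N1 = L2_set (\<lambda>j. cmod (v j)) {..<m + 1}"
  \<comment> \<open>Column 0 of the bordered \<open>Q\<close> is \<open>v / N0\<close> followed by a
    zero, and its last column is the last unit vector. Multiplication by
    \<open>mat_adjoint P\<close> gives \<open>a\<close> times the former minus \<open>b\<close>
    times the latter; comparison with \<open>v / N1\<close> determines both parameters.\<close>
  define a where "a = complex_of_real (N0 / N1)"
  define b where "b = - v m / complex_of_real N1"
  have sq: "N1\<^sup>2 = N0\<^sup>2 + (cmod (v m))\<^sup>2"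
    by (simp add: N0_def N1_def L2_set_def sum_nonneg add_nonneg_nonneg)
  have "N0 \<noteq> 0" using m v by (auto simp: N0_def L2_set_eq_0_iff intro!: exI[of _ 0])
  then have N: "N0 \<noteq> 0" "N1 \<noteq> 0" using sq by (auto simp: sum_power2_eq_zero_iff)
  have "cnj a * a + cnj b * b = complex_of_real ((N0\<^sup>2 + (cmod (v m))\<^sup>2) / N1\<^sup>2)"
    unfolding of_real_divide of_real_add complex_norm_square
    by (simp add: a_def b_def power2_eq_square add_divide_distrib mult.commute)
  then have unit: "cnj a * a + cnj b * b = 1" using sq N by simp
  define P where "P = plane_rotation m 0 a b"
  note bQ = border_mat_carrier[OF unitary_matD(1)[OF Q], of 1]
  have adj: "mat_adjoint P = plane_rotation m 0 (cnj a) (- b)"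
    using m by (simp add: P_def mat_adjoint_plane_rotation)
  have Q0: "Q $$ (r, 0) = v r / complex_of_real N0" if "r < m" for r
    using that m arg_cong[OF col, of "\<lambda>x. x $ r"] unitary_matD(1)[OF Q] by (simp add: N0_def)
  have "col (border_mat Q 1 * mat_adjoint P) 0 = vec (m + 1) (\<lambda>i. v i / complex_of_real N1)"
  proof (rule eq_vecI)
    fix r assume "r < dim_vec (vec (m + 1) (\<lambda>i. v i / complex_of_real N1))"
    then have r: "r < m + 1" by simp
    have "col (border_mat Q 1 * mat_adjoint P) 0 $ r = (border_mat Q 1 * mat_adjoint P) $$ (r, 0)"
      using bQ r by (simp add: adj del: index_mult_mat(1))
    also have "\<dots> = a * border_mat Q 1 $$ (r, 0) - b * border_mat Q 1 $$ (r, m)"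
      using index_mult_plane_rotation[OF bQ _ r, of 0 0 "cnj a" "- b"] adj m by simp
    also have "\<dots> = v r / complex_of_real N1"
    proof (cases "r = m")
      case True
      then show ?thesis
        using m index_border_mat[OF unitary_matD(1)[OF Q] r, of 0 1]
          index_border_mat[OF unitary_matD(1)[OF Q] r, of m 1] by (simp add: b_def)
    next
      case False
      then show ?thesis
        using m r N index_border_mat[OF unitary_matD(1)[OF Q] r, of 0 1]
          index_border_mat[OF unitary_matD(1)[OF Q] r, of m 1] by (simp add: a_def Q0)
    qed
    finally show "col (border_mat Q 1 * mat_adjoint P) 0 $ r
        = vec (m + 1) (\<lambda>i. v i / complex_of_real N1) $ r" using r by simp
  qed (use bQ in auto)
  then show ?thesis
    using that[of P] unit unfolding P_def N1_def plane_rotations_iff by blast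
qed

lemma hpiep_solution_imp_chased:
  assumes m: "m \<ge> 1" and v: "\<forall>i<m + 1. v i \<noteq> 0" and sol: "hpiep_solution m z v \<xi> Q H K"
    and h: "z m * khat = hhat" and k: "khat \<noteq> 0"
  obtains P where "P \<in> plane_rotations m 0"
    "chased m z \<xi> (vec (m + 1) (\<lambda>i. v i / complex_of_real (L2_set (\<lambda>j. cmod (v j)) {..<m + 1}))) 0
       (border_mat Q 1 * mat_adjoint P) (P * border_mat H hhat) (P * border_mat K khat)"
proof -
  have Q: "unitary_mat m Q" and H: "H \<in> carrier_mat m m" and K: "K \<in> carrier_mat m m"
    and hess: "\<And>r c. r < m \<Longrightarrow> c < m \<Longrightarrow> c + 1 < r \<Longrightarrow> H $$ (r, c) = 0 \<and> K $$ (r, c) = 0"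
    and poles: "\<And>c. c + 1 < m \<Longrightarrow> has_pole (\<xi> c) (H $$ (c + 1, c)) (K $$ (c + 1, c))"
    and reg: "regular_pencil H K" and eq: "mat_adjoint Q * mat_diag m z * Q * K = H"
    and col: "col Q 0 = vec m (\<lambda>i. v i / complex_of_real (L2_set (\<lambda>j. cmod (v j)) {..<m}))"
    using sol unfolding hpiep_solution_def proper_hessenberg_pencil_def upper_hessenberg_def
      has_pole_def by auto
  have "pencil_relation m z Q H K"
    using Q H K eq reg regular_pencil_iff_det[OF Q K eq] by (simp add: pencil_relation_def)
  from pencil_relation_border[OF this h k]
  have rel: "pencil_relation (m + 1) z (border_mat Q 1) (border_mat H hhat) (border_mat K khat)" .
  obtain P where P: "P \<in> plane_rotations m 0"
    and w: "col (border_mat Q 1 * mat_adjoint P) 0 =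
       vec (m + 1) (\<lambda>i. v i / complex_of_real (L2_set (\<lambda>j. cmod (v j)) {..<m + 1}))"
    using border_col_rotation[OF Q m v col] by blast
  have m0: "0 < m" using m by simp
  obtain a b where Pab: "P = plane_rotation m 0 a b"
    using P by (auto simp: plane_rotations_iff)
  \<comment> \<open>At index 0, \<open>chased\<close> constrains entries only in rows strictly
    between 0 and \<open>m\<close>. The first rotation leaves these rows alone, so they are
    inherited from \<open>H\<close> and \<open>K\<close>.\<close>
  have idx: "(P * border_mat H hhat) $$ (r, c) = (if c < m then H $$ (r, c) else 0)"
    "(P * border_mat K khat) $$ (r, c) = (if c < m then K $$ (r, c) else 0)"
    if "0 < r" "r < m" "c < m + 1" for r c
    using that index_plane_rotation_mult[OF border_mat_carrier[OF H] m0, of r c a b hhat]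
      index_plane_rotation_mult[OF border_mat_carrier[OF K] m0, of r c a b khat]
    by (simp_all add: Pab index_border_mat[OF H] index_border_mat[OF K])
  have "chased m z \<xi> (vec (m + 1) (\<lambda>i. v i / complex_of_real (L2_set (\<lambda>j. cmod (v j)) {..<m + 1}))) 0
       (border_mat Q 1 * mat_adjoint P) (P * border_mat H hhat) (P * border_mat K khat)"
    unfolding chased_def
    using pencil_relation_mult_left[OF rel unitary_mat_plane_rotation[OF m0 P]] w hess poles
    by (simp add: idx)
  from that[OF P this] show ?thesis .
qed

text \<open>Induction on the chase index. Row rotations run one ahead of column rotations because
  \<open>P0\<close> comes before the first step. \<open>Ps\<close> is reversed in the product since
  each new row rotation multiplies from the left.\<close>

lemma chased_all:
  assumes ch: "chased m z \<xi> w 0 (Q * mat_adjoint P0) (P0 * H) (P0 * K)"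
    and P0: "P0 \<in> plane_rotations m 0"
    and Q: "Q \<in> carrier_mat (m + 1) (m + 1)" and H: "H \<in> carrier_mat (m + 1) (m + 1)"
    and K: "K \<in> carrier_mat (m + 1) (m + 1)"
    and inj: "inj_on z {..<m + 1}" and w: "\<forall>j<m + 1. w $ j \<noteq> 0" and i: "i < m"
  shows "\<exists>Ps Rs. length Ps = i + 1 \<and> length Rs = i \<and>
    (\<forall>j\<le>i. Ps ! j \<in> plane_rotations m j) \<and> (\<forall>j<i. Rs ! j \<in> plane_rotations m j) \<and>
    chased m z \<xi> w i (Q * mat_adjoint (mat_prod_list (m + 1) (rev Ps)))
      (mat_prod_list (m + 1) (rev Ps) * H * mat_prod_list (m + 1) Rs)
      (mat_prod_list (m + 1) (rev Ps) * K * mat_prod_list (m + 1) Rs)"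
  using i
proof (induction i)
  case 0
  have "P0 \<in> carrier_mat (m + 1) (m + 1)"
    using P0 by (rule plane_rotations_carrier)
  then show ?case
    using ch P0 H K by (intro exI[of _ "[P0]"] exI[of _ "[]"]) (simp add: mat_prod_list_simps)
next
  case (Suc i)
  then obtain Ps Rs where len: "length Ps = i + 1" "length Rs = i"
    and Ps: "\<forall>j\<le>i. Ps ! j \<in> plane_rotations m j" and Rs: "\<forall>j<i. Rs ! j \<in> plane_rotations m j"
    and chi: "chased m z \<xi> w i (Q * mat_adjoint (mat_prod_list (m + 1) (rev Ps)))
      (mat_prod_list (m + 1) (rev Ps) * H * mat_prod_list (m + 1) Rs)
      (mat_prod_list (m + 1) (rev Ps) * K * mat_prod_list (m + 1) Rs)"
    by auto
  have i: "i + 1 < m" using Suc by simp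
  obtain R P where R: "R \<in> plane_rotations m i" and P: "P \<in> plane_rotations m (i + 1)"
    and chs: "chased m z \<xi> w (i + 1)
      (Q * mat_adjoint (mat_prod_list (m + 1) (rev Ps)) * mat_adjoint P)
      (P * (mat_prod_list (m + 1) (rev Ps) * H * mat_prod_list (m + 1) Rs * R))
      (P * (mat_prod_list (m + 1) (rev Ps) * K * mat_prod_list (m + 1) Rs * R))"
    by (rule chased_step[OF chi i inj w])
  note car = plane_rotations_carrier
  have "set (rev Ps) \<subseteq> carrier_mat (m + 1) (m + 1)"
    using Ps len plane_rotations_list_carrier[of Ps] by simp
  note PL = mat_prod_list_carrier[OF this]
  have RsC: "set Rs \<subseteq> carrier_mat (m + 1) (m + 1)"
    using Rs len plane_rotations_list_carrier[of Rs] by simp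
  note RL = mat_prod_list_carrier[OF RsC]
  note RR = mat_prod_list_snoc[OF RsC car[OF R]]
  note assoc = assoc_mult_mat[of _ "m + 1" "m + 1" _ "m + 1" _ "m + 1"]
    mult_carrier_mat[of _ "m + 1" "m + 1" _ "m + 1"]
  have eq: "P * (mat_prod_list (m + 1) (rev Ps) * X * mat_prod_list (m + 1) Rs * R)
      = mat_prod_list (m + 1) (rev (Ps @ [P])) * X * mat_prod_list (m + 1) (Rs @ [R])"
    if X: "X \<in> carrier_mat (m + 1) (m + 1)" for X
    using PL RL car[OF R] car[OF P] X unfolding RR rev_append rev.simps append.simps mat_prod_list_simps
    by (simp only: assoc)
  have eqQ: "Q * mat_adjoint (mat_prod_list (m + 1) (rev Ps)) * mat_adjoint P
      = Q * mat_adjoint (mat_prod_list (m + 1) (rev (Ps @ [P])))"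
    using assoc_mult_mat[OF Q mat_adjoint_carrier[OF PL] mat_adjoint_carrier[OF car[OF P]]]
    unfolding rev_append rev.simps append.simps mat_prod_list_simps mat_adjoint_mult[OF car[OF P] PL]
    by simp
  show ?case
  proof (intro exI conjI)
    show "length (Ps @ [P]) = Suc i + 1" "length (Rs @ [R]) = Suc i" using len by simp_all
    show "\<forall>j\<le>Suc i. (Ps @ [P]) ! j \<in> plane_rotations m j"
      using Ps P len by (auto simp: nth_append le_Suc_eq)
    show "\<forall>j<Suc i. (Rs @ [R]) ! j \<in> plane_rotations m j"
      using Rs R len by (auto simp: nth_append less_Suc_eq)
    show "chased m z \<xi> w (Suc i) (Q * mat_adjoint (mat_prod_list (m + 1) (rev (Ps @ [P]))))
      (mat_prod_list (m + 1) (rev (Ps @ [P])) * H * mat_prod_list (m + 1) (Rs @ [R]))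
      (mat_prod_list (m + 1) (rev (Ps @ [P])) * K * mat_prod_list (m + 1) (Rs @ [R]))"
      using chs unfolding eq[OF H] eq[OF K] eqQ by simp
  qed
qed

text \<open>At the last index, row \<open>i + 1\<close> is the last row itself, so the pair at
  \<open>(m, i)\<close> is the new subdiagonal pair. It must receive the pole \<open>\<xi> i\<close>
  instead of being annihilated: a column rotation suffices, and \<open>t \<noteq> 0\<close> makes
  the pole proper.\<close>

lemma chased_imp_hpiep_solution:
  assumes ch: "chased m z \<xi> w i Q A B" and i: "i + 1 = m" and inj: "inj_on z {..<m + 1}"
    and w: "\<forall>j<m + 1. w $ j \<noteq> 0"
    and w_eq: "w = vec (m + 1) (\<lambda>i. v i / complex_of_real (L2_set (\<lambda>j. cmod (v j)) {..<m + 1}))"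
  obtains R where "R \<in> plane_rotations m i" "hpiep_solution (m + 1) z v \<xi> Q (A * R) (B * R)"
proof -
  obtain \<mu> \<nu> where \<mu>\<nu>: "\<mu> \<noteq> 0 \<or> \<nu> \<noteq> 0"
    and pole: "\<And>h k. has_pole (\<xi> i) h k \<longleftrightarrow> (\<exists>s. s \<noteq> 0 \<and> h = s * \<mu> \<and> k = s * \<nu>)"
    using has_pole_homogeneous[of "\<xi> i"] by blast
  have i': "i < m" using i by simp
  obtain R t where R: "R \<in> plane_rotations m i"
    and rel: "pencil_relation (m + 1) z Q (A * R) (B * R)"
    and same: "\<forall>r<m + 1. \<forall>c<m. c \<noteq> i \<longrightarrow>
       (A * R) $$ (r, c) = A $$ (r, c) \<and> (B * R) $$ (r, c) = B $$ (r, c)"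
    and t: "(A * R) $$ (m, i) = t * \<mu>" "(B * R) $$ (m, i) = t * \<nu>" and "t \<noteq> 0"
    using chased_column_step[OF ch i' inj w \<mu>\<nu> pole] i by blast
  have Q0: "col Q 0 = w"
    and hess: "\<And>r c. r < m \<Longrightarrow> c < m \<Longrightarrow> c + 1 < r \<Longrightarrow> A $$ (r, c) = 0 \<and> B $$ (r, c) = 0"
    and poles: "\<And>c. c + 1 < m \<Longrightarrow> has_pole (\<xi> c) (A $$ (c + 1, c)) (B $$ (c + 1, c))"
    and lastrow: "\<And>c. c < i \<Longrightarrow> A $$ (m, c) = 0 \<and> B $$ (m, c) = 0"
    using ch unfolding chased_def by auto
  have Q: "unitary_mat (m + 1) Q" and A: "A * R \<in> carrier_mat (m + 1) (m + 1)"
    and B: "B * R \<in> carrier_mat (m + 1) (m + 1)" and det: "det (B * R) \<noteq> 0"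
    and eq: "mat_adjoint Q * mat_diag (m + 1) z * Q * (B * R) = A * R"
    using rel by (auto simp: pencil_relation_def)
  have hessR: "(A * R) $$ (r, c) = 0 \<and> (B * R) $$ (r, c) = 0"
    if "r < m + 1" "c < m + 1" "c + 1 < r" for r c
  proof -
    have c: "c < m" "c < i" "c \<noteq> i" using that i by auto
    have "A $$ (r, c) = 0 \<and> B $$ (r, c) = 0"
      using that c hess[of r c] lastrow[of c] by (cases "r = m") auto
    then show ?thesis using same that c by simp
  qed
  have polesR: "has_pole (\<xi> c) ((A * R) $$ (c + 1, c)) ((B * R) $$ (c + 1, c))"
    if c: "c + 1 < m + 1" for c
  proof (cases "c = i")
    case True
    then show ?thesis using pole t \<open>t \<noteq> 0\<close> i by (simp add: exI[of _ t])
  next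
    case False
    then show ?thesis using c i poles[of c] same by simp
  qed
  have "hpiep_solution (m + 1) z v \<xi> Q (A * R) (B * R)"
    unfolding hpiep_solution_def proper_hessenberg_pencil_def upper_hessenberg_def
    using Q A B hessR polesR eq regular_pencil_iff_det[OF Q B eq] det Q0 w_eq
    unfolding has_pole_def by blast
  from that[OF R this] show ?thesis .
qed

theorem theorem4p1:
  fixes m :: nat and z v :: "nat \<Rightarrow> complex" and \<xi> :: "nat \<Rightarrow> complex option"
    and Q H K :: "complex mat" and hhat khat :: complex
  assumes "m \<ge> 1"
    and "inj_on z {..<m + 1}"
    and "\<forall>i<m + 1. v i \<noteq> 0"
    and "\<forall>i<m. \<forall>j<m + 1. \<xi> i \<noteq> Some (z j)"
    and "hpiep_solution m z v \<xi> Q H K"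
    and "z m * khat = hhat"
    and "khat \<noteq> 0"
  shows "\<exists>P Pdot :: nat \<Rightarrow> complex mat.
     (\<forall>i<m. P i \<in> plane_rotations m i \<and> Pdot i \<in> plane_rotations m i) \<and>
     hpiep_solution (m + 1) z v \<xi>
       (border_mat Q 1 * mat_prod_list (m + 1) (map (\<lambda>i. mat_adjoint (P i)) [0..<m]))
       (mat_prod_list (m + 1) (map P (rev [0..<m])) * border_mat H hhat *
          mat_prod_list (m + 1) (map Pdot [0..<m]))
       (mat_prod_list (m + 1) (map P (rev [0..<m])) * border_mat K khat *
          mat_prod_list (m + 1) (map Pdot [0..<m]))"
proof -
  define w where
    "w = vec (m + 1) (\<lambda>i. v i / complex_of_real (L2_set (\<lambda>j. cmod (v j)) {..<m + 1}))"
  have carr: "Q \<in> carrier_mat m m" "H \<in> carrier_mat m m" "K \<in> carrier_mat m m"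
    using assms(5) by (auto simp: hpiep_solution_def unitary_mat_def
        proper_hessenberg_pencil_def upper_hessenberg_def)
  note bc = border_mat_carrier[OF carr(1), of 1] border_mat_carrier[OF carr(2), of hhat]
    border_mat_carrier[OF carr(3), of khat]
  have "L2_set (\<lambda>j. cmod (v j)) {..<m + 1} \<noteq> 0"
    using assms(3) by (auto simp: L2_set_eq_0_iff)
  then have w: "\<forall>j<m + 1. w $ j \<noteq> 0" using assms(3) by (simp add: w_def)
  obtain P0 where P0: "P0 \<in> plane_rotations m 0" and ch0: "chased m z \<xi> w 0
      (border_mat Q 1 * mat_adjoint P0) (P0 * border_mat H hhat) (P0 * border_mat K khat)"
    using hpiep_solution_imp_chased[OF assms(1,3,5,6,7)] unfolding w_def by blast
  define i where "i = m - 1"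
  have i: "i < m" "i + 1 = m" using assms(1) by (auto simp: i_def)
  let ?M = "mat_prod_list (m + 1)"
  obtain Ps Rs where len: "length Ps = i + 1" "length Rs = i"
    and Ps: "\<forall>j\<le>i. Ps ! j \<in> plane_rotations m j" and Rs: "\<forall>j<i. Rs ! j \<in> plane_rotations m j"
    and ch: "chased m z \<xi> w i (border_mat Q 1 * mat_adjoint (?M (rev Ps)))
      (?M (rev Ps) * border_mat H hhat * ?M Rs) (?M (rev Ps) * border_mat K khat * ?M Rs)"
    using chased_all[OF ch0 P0 bc assms(2) w i(1)] by blast
  obtain R where R: "R \<in> plane_rotations m i"
    and sol: "hpiep_solution (m + 1) z v \<xi> (border_mat Q 1 * mat_adjoint (?M (rev Ps)))
      (?M (rev Ps) * border_mat H hhat * ?M Rs * R) (?M (rev Ps) * border_mat K khat * ?M Rs * R)"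
    by (rule chased_imp_hpiep_solution[OF ch i(2) assms(2) w w_def])
  \<comment> \<open>The closing column rotation brings the number of column rotations up to that of
    the row rotations, namely \<open>m\<close>.\<close>
  define Rs' where "Rs' = Rs @ [R]"
  have len': "length Ps = m" "length Rs' = m" using len i by (auto simp: Rs'_def)
  have rot: "Ps ! j \<in> plane_rotations m j \<and> Rs' ! j \<in> plane_rotations m j" if "j < m" for j
    using that Ps Rs R len i by (cases "j = i") (auto simp: Rs'_def nth_append)
  note car = plane_rotations_carrier
  have PsC: "set (rev Ps) \<subseteq> carrier_mat (m + 1) (m + 1)"
    using rot len' plane_rotations_list_carrier[of Ps] by simp
  have RsC: "set Rs \<subseteq> carrier_mat (m + 1) (m + 1)"
    using Rs len plane_rotations_list_carrier[of Rs] by simp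
  have maps: "map ((!) Ps) [0..<m] = Ps" "map ((!) Rs') [0..<m] = Rs'"
    using map_nth[of Ps] map_nth[of Rs'] len' by auto
  have mapP: "map ((!) Ps) (rev [0..<m]) = rev Ps"
    using maps(1) by (metis rev_map)
  have mapQ: "map (\<lambda>i. mat_adjoint (Ps ! i)) [0..<m] = map mat_adjoint (rev (rev Ps))"
    using arg_cong[OF maps(1), of "map mat_adjoint"] by (simp add: comp_def)
  have RR: "?M (rev Ps) * X * ?M Rs * R = ?M (rev Ps) * X * ?M Rs'"
    if X: "X \<in> carrier_mat (m + 1) (m + 1)" for X
    unfolding Rs'_def mat_prod_list_snoc[OF RsC car[OF R]]
    by (rule assoc_mult_mat[OF mult_carrier_mat[OF mat_prod_list_carrier[OF PsC] X]
          mat_prod_list_carrier[OF RsC] car[OF R]])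
  show ?thesis
  proof (intro exI conjI)
    show "\<forall>i<m. Ps ! i \<in> plane_rotations m i \<and> Rs' ! i \<in> plane_rotations m i"
      using rot by blast
    show "hpiep_solution (m + 1) z v \<xi>
       (border_mat Q 1 * ?M (map (\<lambda>i. mat_adjoint (Ps ! i)) [0..<m]))
       (?M (map ((!) Ps) (rev [0..<m])) * border_mat H hhat * ?M (map ((!) Rs') [0..<m]))
       (?M (map ((!) Ps) (rev [0..<m])) * border_mat K khat * ?M (map ((!) Rs') [0..<m]))"
      using sol unfolding mapQ mapP maps(2) RR[OF bc(2)] RR[OF bc(3)]
        mat_adjoint_mat_prod_list[OF PsC] .
  qed
qed

end
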